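(* There exists a compact nonempty set $K$ in $P(\mathbb Q)$ such that (i) $\mathrm{supp}(\mu)$ is locally compact for every $\mu\in K$, and $\mathrm{supp}(\mu)\cap\mathrm{supp}(\nu)$ is finite for all distinct $\mu,\nu\in K$; (ii) any nonempty (relatively) open set $V$ in $K$ contains a compact set $L$ such that, whenever $A\subseteq K$ is $\sigma$-uniformly tight, $L\setminus A$ contains a non-uniformly tight compact set.
   Context: $\mathbb Q$ is the space of rationals with its usual topology. $P(\mathbb Q)$ is the space of probability Borel measures on $\mathbb Q$ with the weak topology (the topology of weak convergence, tested against bounded continuous functions). For $\mu\in P(\mathbb Q)$, $\mathrm{supp}(\mu)$ is the closure in $\mathbb Q$ of $\{q\in\mathbb Q:\mu(\{q\})>0\}$. A set $A\subseteq P(\mathbb Q)$ is uniformly tight if for every $\varepsilon>0$ there is a compact set $C\subseteq\mathbb Q$ with $\mu(\mathbb Q\setminus C)<\varepsilon$ for all $\mu\in A$; it is $\sigma$-uniformly tight if it is covered by countably many uniformly tight sets. *)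

theory Defs
  imports "HOL-Probability.Probability"
begin

text \<open>
  The space of rationals is the set \<open>\<rat>\<close> of reals with the subspace topology; its Borel
  sigma-algebra is the trace of the Borel sigma-algebra of the reals
  (see \<open>sets_restrict_borel_Rats\<close>).
\<close>

lemma sets_restrict_borel_Rats:
  "sets (restrict_space borel (\<rat> :: real set)) =
     sigma_sets \<rat> {U. openin (top_of_set \<rat>) U}"
proof -
  have "sets (restrict_space borel (\<rat> :: real set)) =
      sets (vimage_algebra \<rat> (\<lambda>x. x) (sigma UNIV {S :: real set. open S}))"
    by (simp add: restrict_space_eq_vimage_algebra' borel_def)
  also have "\<dots> = sigma_sets \<rat> {(\<lambda>x. x) -` A \<inter> \<rat> | A. A \<in> {S :: real set. open S}}"
    by (subst vimage_algebra_sigma) (simp_all, intro sets_measure_of, auto)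
  also have "{(\<lambda>x. x) -` A \<inter> \<rat> | A. A \<in> {S :: real set. open S}} = {U. openin (top_of_set \<rat>) U}"
    by (auto simp: openin_open)
  finally show ?thesis .
qed

definition prob_rats :: "real measure set" where
  "prob_rats = {\<mu>. prob_space \<mu> \<and> sets \<mu> = sets (restrict_space borel \<rat>)}"

definition weak_topology :: "real measure topology" where
  "weak_topology = topology_generated_by
     {{\<mu> \<in> prob_rats. (\<integral>x. f x \<partial>\<mu>) \<in> U} | f U.
        continuous_on \<rat> f \<and> bounded (f ` \<rat>) \<and> open (U :: real set)}"

lemma topspace_weak_topology: "topspace weak_topology = prob_rats"
proof -
  have "prob_rats = {\<mu> \<in> prob_rats. (\<integral>x. (\<lambda>_. 0 :: real) x \<partial>\<mu>) \<in> UNIV}"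
    by simp
  moreover have "continuous_on \<rat> (\<lambda>_ :: real. 0 :: real)" "bounded ((\<lambda>_ :: real. 0 :: real) ` \<rat>)"
    by (auto intro: boundedI[of _ 0])
  ultimately have "prob_rats \<in> {{\<mu> \<in> prob_rats. (\<integral>x. f x \<partial>\<mu>) \<in> U} | f U.
      continuous_on \<rat> f \<and> bounded (f ` \<rat>) \<and> open (U :: real set)}"
    using open_UNIV by blast
  then show ?thesis
    unfolding weak_topology_def topology_generated_by_topspace by blast
qed

definition supp :: "real measure \<Rightarrow> real set" where
  "supp \<mu> = top_of_set \<rat> closure_of {q \<in> \<rat>. measure \<mu> {q} > 0}"

definition uniformly_tight :: "real measure set \<Rightarrow> bool" where
  "uniformly_tight A \<longleftrightarrow> A \<subseteq> prob_rats \<and>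
     (\<forall>\<epsilon>>0. \<exists>C. C \<subseteq> \<rat> \<and> compact C \<and> (\<forall>\<mu>\<in>A. measure \<mu> (\<rat> - C) < \<epsilon>))"

definition sigma_uniformly_tight :: "real measure set \<Rightarrow> bool" where
  "sigma_uniformly_tight A \<longleftrightarrow>
     (\<exists>\<F>. countable \<F> \<and> (\<forall>B\<in>\<F>. uniformly_tight B) \<and> A \<subseteq> \<Union>\<F>)"

end

theory Submission
  imports Defs
begin

text \<open>
  A particle \<open>w\<close> of a Gaussian random variable belongs to the process \<open>n = nat \<lfloor>w\<rfloor>\<close>. Every process
  starts with all its mass at one point, and runs through dyadic subintervals of \<open>[0, 1)\<close> in depth-first
  order: at each stage either the particles whose fractional part lies in the current interval
  are all shifted to the right by the reciprocal of a factorial, and the process passes to the left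
  half of the interval, or these particles are final, and the process passes to the next interval.
  Depth-first order lets at most one particle of a process be shifted infinitely often, so
  almost every particle stops at a rational number. The decisions are the bits of a sequence
  \<open>x\<close>, and since the final position of every particle depends continuously on \<open>x\<close>, the laws \<open>law x\<close>
  form a compact set.

  Infinite sums of reciprocals of distinct factorials are irrational. Hence a process
  which declares particles final exactly when they have left a given compact set of rationals
  must come to an end, with its whole mass outside that set. Given a \<open>\<sigma>\<close>-uniformly tight set,
  all but finitely many processes can be used to escape from its countably many pieces, while one more process
  remains free to escape from any prescribed compact set.

  The size of a shift encodes all earlier bits of \<open>x\<close>, which makes the supports of distinct
  laws almost disjoint. The positions of a process accumulate at most at one point, which is
  irrational, so the supports are closed and discrete in the rationals.
\<close>

subsection \<open>Subsums of reciprocal factorials\<close>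

definition ssum :: "(nat \<Rightarrow> nat) \<Rightarrow> nat set \<Rightarrow> real" where
  "ssum d S = (\<Sum>j. of_bool (j \<in> S) / fact (d j))"

text \<open>With labels from 3 on, the weights \<open>1 / fact (d j)\<close> drop by a factor of at
  least 3 at each index, uniformly in \<open>d\<close>.\<close>

definition labelling :: "(nat \<Rightarrow> nat) \<Rightarrow> bool" where
  "labelling d \<longleftrightarrow> strict_mono d \<and> 3 \<le> d 0"

lemma labelling_ge:
  assumes "labelling d"
  shows "j + 3 \<le> d j"
proof (induction j)
  case 0
  then show ?case using assms by (simp add: labelling_def)
next
  case (Suc j)
  moreover have "d j < d (Suc j)"
    using assms by (simp add: labelling_def strict_mono_def)
  ultimately show ?case by linarith
qed

lemma fact_label_ge:
  assumes "labelling d" "m \<le> j"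
  shows "fact (d m) * 3 ^ (j - m) \<le> (fact (d j) :: real)"
  using assms(2)
proof (induction j rule: dec_induct)
  case base
  then show ?case by simp
next
  case (step j)
  have lt: "d j < d (Suc j)"
    using assms by (simp add: labelling_def strict_mono_def)
  have "fact (d m) * 3 ^ (Suc j - m) = 3 * (fact (d m) * 3 ^ (j - m) :: real)"
    using step by (simp add: Suc_diff_le)
  also have "\<dots> \<le> 3 * fact (d j)"
    using step by simp
  also have "\<dots> \<le> real (Suc (d j)) * fact (d j)"
    using labelling_ge[OF assms(1), of j] by (intro mult_right_mono) auto
  also have "\<dots> = fact (Suc (d j))" by simp
  also have "\<dots> \<le> fact (d (Suc j))"
    using lt by (intro fact_mono) auto
  finally show ?case .
qed

lemma label_weight_le:
  assumes "labelling d" "m \<le> j"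
  shows "1 / fact (d j) \<le> (1 / fact (d m)) * (1 / 3 ^ (j - m) :: real)"
  using fact_label_ge[OF assms] by (simp add: divide_simps)

lemma label_weight_le_power:
  assumes "labelling d"
  shows "1 / fact (d j) \<le> (1 / 3 ^ j :: real)"
proof -
  have "1 / fact (d j) \<le> (1 / fact (d 0)) * (1 / 3 ^ (j - 0) :: real)"
    by (intro label_weight_le assms) simp
  also have "\<dots> \<le> 1 * (1 / 3 ^ j)"
    by (intro mult_mono) (auto simp: fact_ge_1)
  finally show ?thesis by simp
qed

lemma summable_third: "summable (\<lambda>j. 1 / 3 ^ j :: real)"
  using summable_geometric[of "1/3 :: real"] by (simp add: power_one_over)

lemma summable_label_weights:
  assumes "labelling d"
  shows "summable (\<lambda>j. of_bool (j \<in> S) / fact (d j) :: real)"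
  by (rule summable_comparison_test[OF _ summable_third])
     (use label_weight_le_power[OF assms] in \<open>auto simp: of_bool_def\<close>)

lemma ssum_nonneg: "labelling d \<Longrightarrow> 0 \<le> ssum d S"
  unfolding ssum_def by (intro suminf_nonneg summable_label_weights) auto

lemma ssum_pos:
  assumes "labelling d" "j \<in> S"
  shows "0 < ssum d S"
  unfolding ssum_def using assms
  by (intro suminf_pos2[where i = j] summable_label_weights) auto

lemma ssum_Un:
  assumes "labelling d" "A \<inter> B = {}"
  shows "ssum d (A \<union> B) = ssum d A + ssum d B"
proof -
  have "(\<lambda>j. of_bool (j \<in> A \<union> B) / fact (d j) :: real) =
      (\<lambda>j. of_bool (j \<in> A) / fact (d j) + of_bool (j \<in> B) / fact (d j))"
    using assms(2) by (auto simp: fun_eq_iff of_bool_def)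
  then show ?thesis
    unfolding ssum_def using assms(1) by (simp add: suminf_add summable_label_weights)
qed

lemma ssum_finite:
  assumes "finite S"
  shows "ssum d S = (\<Sum>j\<in>S. 1 / fact (d j))"
proof -
  have "ssum d S = (\<Sum>j\<in>S. of_bool (j \<in> S) / fact (d j))"
    unfolding ssum_def using assms by (intro suminf_finite) auto
  then show ?thesis by simp
qed

text \<open>Comparison with the geometric series of ratio 1/3, whose sum is 3/2.\<close>

lemma ssum_tail_le:
  assumes "labelling d" "S \<subseteq> {m..}"
  shows "ssum d S \<le> 3 / 2 / fact (d m)"
proof -
  have s3: "(\<lambda>j. 1 / fact (d m) * (1 / 3 ^ j)) sums (3 / 2 / fact (d m) :: real)"
    using sums_mult[OF geometric_sums[of "1/3 :: real"], of "1 / fact (d m)"]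
    by (simp add: power_one_over field_simps)
  have sm: "summable (\<lambda>j. of_bool (j \<in> S) / fact (d j) :: real)"
    by (rule summable_label_weights[OF assms(1)])
  have "ssum d S = (\<Sum>j. of_bool (j + m \<in> S) / fact (d (j + m))) + (\<Sum>j<m. of_bool (j \<in> S) / fact (d j))"
    unfolding ssum_def using suminf_split_initial_segment[OF sm, of m] by simp
  also have "(\<Sum>j<m. of_bool (j \<in> S) / fact (d j)) = (0 :: real)"
    using assms(2) by (intro sum.neutral) auto
  also have "(\<Sum>j. of_bool (j + m \<in> S) / fact (d (j + m))) \<le> (\<Sum>j. 1 / fact (d m) * (1 / 3 ^ j) :: real)"
  proof (rule suminf_le)
    fix j
    show "of_bool (j + m \<in> S) / fact (d (j + m)) \<le> 1 / fact (d m) * (1 / 3 ^ j :: real)"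
      using label_weight_le[OF assms(1), of m "j + m"] by (auto simp: of_bool_def)
  next
    show "summable (\<lambda>j. of_bool (j + m \<in> S) / fact (d (j + m)) :: real)"
      using summable_ignore_initial_segment[OF sm] .
    show "summable (\<lambda>j. 1 / fact (d m) * (1 / 3 ^ j) :: real)"
      using s3 by (rule sums_summable)
  qed
  also have "\<dots> = 3 / 2 / fact (d m)"
    using s3 by (rule sums_unique[symmetric])
  finally show ?thesis by simp
qed

lemma ssum_split:
  assumes "labelling d"
  shows "ssum d S = ssum d (S \<inter> {..<m}) + ssum d (S \<inter> {m..})"
proof -
  have "ssum d ((S \<inter> {..<m}) \<union> (S \<inter> {m..})) = ssum d (S \<inter> {..<m}) + ssum d (S \<inter> {m..})"
    by (rule ssum_Un[OF assms]) auto
  moreover have "(S \<inter> {..<m}) \<union> (S \<inter> {m..}) = S" by auto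
  ultimately show ?thesis by simp
qed

section \<open>Denominators and irrationality of subsums\<close>

lemma fact_mult_ssum_Ints:
  assumes "finite S" "\<And>j. j \<in> S \<Longrightarrow> d j \<le> N"
  shows "fact N * ssum d S \<in> \<int>"
proof -
  have "fact N * ssum d S = (\<Sum>j\<in>S. fact N / fact (d j))"
    using assms(1) by (simp add: ssum_finite sum_distrib_left)
  also have "\<dots> \<in> \<int>"
  proof (rule Ints_sum)
    fix j assume "j \<in> S"
    then have "(fact (d j) :: nat) dvd fact N"
      using assms(2) by (intro fact_dvd) auto
    then obtain k where "(fact N :: nat) = fact (d j) * k" by (elim dvdE)
    then have "(fact N :: real) = fact (d j) * real k"
      by (metis of_nat_fact of_nat_mult)
    then show "fact N / fact (d j) \<in> (\<int> :: real set)" by simp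
  qed
  finally show ?thesis .
qed

lemma ssum_finite_Rats: "finite S \<Longrightarrow> ssum d S \<in> \<rat>"
  by (auto simp: ssum_finite divide_inverse intro!: Rats_sum Rats_inverse)
     (metis Rats_of_nat of_nat_fact)

text \<open>The factorial just below a late label clears a supposed denominator and the head of the
  series, and leaves a tail strictly between 0 and 1.\<close>

lemma ssum_infinite_irrational:
  assumes d: "labelling d" and "infinite S"
  shows "ssum d S \<notin> \<rat>"
proof
  assume "ssum d S \<in> \<rat>"
  then obtain a b where b: "b > 0" and ab: "ssum d S = of_int a / of_nat b"
    by (elim Rats_cases') (metis of_int_of_nat_eq of_nat_0_less_iff pos_int_cases)
  obtain m where m: "m \<in> S" "b \<le> m"
    using \<open>infinite S\<close> by (meson infinite_nat_iff_unbounded_le)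
  define N where "N = d m - 1"
  have dm: "d m = Suc N" "b \<le> N" "2 \<le> N"
    using labelling_ge[OF d, of m] m by (auto simp: N_def)
  have "b dvd fact N" using b dm by (intro dvd_fact) auto
  then obtain k where "(fact N :: nat) = b * k" by (elim dvdE)
  then have k: "(fact N :: real) = real b * real k" by (metis of_nat_fact of_nat_mult)
  have "fact N * ssum d S = of_int (int k * a)"
    using b by (simp add: ab k)
  then have "fact N * ssum d S \<in> \<int>" by simp
  moreover have "fact N * ssum d (S \<inter> {..<m}) \<in> \<int>"
  proof (rule fact_mult_ssum_Ints)
    fix j assume "j \<in> S \<inter> {..<m}"
    then have "d j < d m" using d by (simp add: labelling_def strict_mono_def)
    then show "d j \<le> N" using dm by simp
  qed simp
  ultimately have "fact N * ssum d S - fact N * ssum d (S \<inter> {..<m}) \<in> \<int>"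
    by (rule Ints_diff)
  then have "fact N * ssum d (S \<inter> {m..}) \<in> \<int>"
    by (simp add: ssum_split[OF d, of S m] algebra_simps)
  moreover have "0 < fact N * ssum d (S \<inter> {m..})"
    using ssum_pos[OF d, of m "S \<inter> {m..}"] m by simp
  moreover have "fact N * ssum d (S \<inter> {m..}) < 1"
  proof -
    have "fact N * ssum d (S \<inter> {m..}) \<le> fact N * (3 / 2 / fact (d m))"
      by (intro mult_left_mono ssum_tail_le d) auto
    also have "\<dots> = 3 / 2 / real (Suc N)"
      by (simp only: dm fact_Suc) (simp add: divide_simps)
    also have "\<dots> < 1" using dm(3) by (simp add: divide_simps)
    finally show ?thesis .
  qed
  ultimately show False
    by (auto elim!: Ints_cases)
qed

text \<open>After multiplication by \<open>fact (d m - 1)\<close> only the last summand survives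
  modulo integers, as the reciprocal of \<open>d m\<close>. A finite subsum thus reveals its largest
  label.\<close>

lemma fact_mult_ssum_top:
  assumes d: "labelling d" and S: "finite S" "\<And>j. j \<in> S \<Longrightarrow> j < m"
  shows "fact (d m) * ssum d (insert m S) \<in> \<int>"
    and "fact (d m - 1) * ssum d (insert m S) \<notin> \<int>"
proof -
  have mono: "d j < d m" if "j \<in> S" for j
    using S(2)[OF that] d by (simp add: labelling_def strict_mono_def)
  then show "fact (d m) * ssum d (insert m S) \<in> \<int>"
    using S(1) by (intro fact_mult_ssum_Ints) (auto intro: less_imp_le)
  obtain N where N: "d m = Suc N" "2 \<le> N"
    using labelling_ge[OF d, of m] by (cases "d m") auto
  have i1: "fact N * ssum d S \<in> \<int>"
    using mono N S(1) by (intro fact_mult_ssum_Ints) (auto simp: less_Suc_eq_le)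
  have "m \<notin> S" using S(2) by blast
  then have "ssum d (insert m S) = 1 / fact (d m) + ssum d S"
    using S(1) by (simp add: ssum_finite)
  then have "fact N * ssum d (insert m S) - fact N * ssum d S = fact N / fact (Suc N)"
    by (simp only: N ring_distribs) simp
  also have "\<dots> = 1 / real (Suc N)"
    by (simp only: fact_Suc) (simp add: divide_simps)
  finally have eq: "fact N * ssum d (insert m S) - fact N * ssum d S = 1 / real (Suc N)" .
  have "0 < 1 / real (Suc N)" "1 / real (Suc N) < 1"
    using N by auto
  then have "1 / real (Suc N) \<notin> \<int>"
    using Ints_nonzero_abs_ge1[of "1 / real (Suc N)"] by auto
  then show "fact (d m - 1) * ssum d (insert m S) \<notin> \<int>"
    using i1 eq by (metis Ints_diff N(1) diff_Suc_1)
qed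

text \<open>Dominated convergence for series: every term is eventually constant, and the bound
  \<open>1 / 3 ^ j\<close> serves all labellings at once.\<close>

lemma tendsto_ssum:
  assumes d: "\<And>k. labelling (d k)"
    and ev: "\<And>j. \<forall>\<^sub>F k in sequentially. (j \<in> S k \<longleftrightarrow> j \<in> T) \<and> d k j = e j"
  shows "(\<lambda>k. ssum (d k) (S k)) \<longlonglongrightarrow> ssum e T"
  unfolding ssum_def
proof -
  have lim: "(\<lambda>k. of_bool (j \<in> S k) / fact (d k j) :: real) \<longlonglongrightarrow> of_bool (j \<in> T) / fact (e j)" for j
    by (rule tendsto_eventually, rule eventually_mono[OF ev[of j]]) auto
  have "norm (of_bool (j \<in> S k) / fact (d k j) :: real) \<le> 1 / 3 ^ j" for j k
    using label_weight_le_power[OF d, of k j] by (auto simp: of_bool_def)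
  then have "\<forall>\<^sub>F (j, k) in at_top \<times>\<^sub>F sequentially.
      norm (of_bool (j \<in> S k) / fact (d k j) :: real) \<le> 1 / 3 ^ j"
    by (intro always_eventually) auto
  from tannerys_theorem[OF lim this summable_third]
  show "(\<lambda>k. \<Sum>j. of_bool (j \<in> S k) / fact (d k j) :: real) \<longlonglongrightarrow> (\<Sum>j. of_bool (j \<in> T) / fact (e j))"
    by simp
qed

subsection \<open>Depth-first traversal of dyadic intervals\<close>

text \<open>
  The state \<open>(a, k)\<close> stands for the interval \<open>[a, a + 2\<^sup>-\<^sup>k)\<close>. After the interval ending at \<open>b\<close> has been
  left for good, the next interval in depth-first order is the longest dyadic interval with left
  endpoint \<open>b\<close>, whence the \<open>LEAST\<close>. A traversal which has exhausted \<open>[0, 1)\<close> goes on harmlessly to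
  the right of \<open>1\<close>.
\<close>
primrec dyad :: "(nat \<Rightarrow> bool) \<Rightarrow> nat \<Rightarrow> real \<times> nat" where
  "dyad c 0 = (0, 0)"
| "dyad c (Suc i) = (let (a, k) = dyad c i in
     if c i then (a, Suc k)
     else (a + 1 / 2 ^ k, LEAST k'. (a + 1 / 2 ^ k) * 2 ^ k' \<in> \<int>))"

definition lft :: "(nat \<Rightarrow> bool) \<Rightarrow> nat \<Rightarrow> real" where
  "lft c i = fst (dyad c i)"

definition lev :: "(nat \<Rightarrow> bool) \<Rightarrow> nat \<Rightarrow> nat" where
  "lev c i = snd (dyad c i)"

definition rgt :: "(nat \<Rightarrow> bool) \<Rightarrow> nat \<Rightarrow> real" where
  "rgt c i = lft c i + 1 / 2 ^ lev c i"

definition moves :: "(nat \<Rightarrow> bool) \<Rightarrow> real \<Rightarrow> nat set" where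
  "moves c r = {j. c j \<and> lft c j \<le> r \<and> r < rgt c j}"

text \<open>By nesting, all particles of the interval at stage \<open>i\<close> share these earlier
  shifts, so the left endpoint can represent the whole block.\<close>

definition past :: "(nat \<Rightarrow> bool) \<Rightarrow> nat \<Rightarrow> nat set" where
  "past c i = moves c (lft c i) \<inter> {..<i}"

text \<open>The stages whose interval is never left: the branch along which an unfinished traversal descends.\<close>
definition spine :: "(nat \<Rightarrow> bool) \<Rightarrow> nat set" where
  "spine c = {j. \<forall>i>j. lft c i < rgt c j}"

lemma lft_0 [simp]: "lft c 0 = 0" and lev_0 [simp]: "lev c 0 = 0" and rgt_0 [simp]: "rgt c 0 = 1"
  by (simp_all add: lft_def lev_def rgt_def)

lemma lft_Suc_True: "c i \<Longrightarrow> lft c (Suc i) = lft c i"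
  and lev_Suc_True: "c i \<Longrightarrow> lev c (Suc i) = Suc (lev c i)"
  and lft_Suc_False: "\<not> c i \<Longrightarrow> lft c (Suc i) = rgt c i"
  and lev_Suc_False: "\<not> c i \<Longrightarrow> lev c (Suc i) = (LEAST k. rgt c i * 2 ^ k \<in> \<int>)"
  by (simp_all add: lft_def lev_def rgt_def Let_def split: prod.splits)

lemma lft_less_rgt: "lft c i < rgt c i"
  by (simp add: rgt_def)

lemma lft_mono: "i \<le> j \<Longrightarrow> lft c i \<le> lft c j"
proof (induction j rule: dec_induct)
  case (step j)
  then show ?case
    using lft_less_rgt[of c j] by (cases "c j") (auto simp: lft_Suc_True lft_Suc_False)
qed simp

lemma dyadic_scale_up:
  fixes a :: real
  assumes "a * 2 ^ k \<in> \<int>" "k \<le> l"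
  shows "a * 2 ^ l \<in> \<int>"
proof -
  have "(2::real) ^ l = 2 ^ k * 2 ^ (l - k)"
    using assms(2) by (simp flip: power_add)
  then have "a * 2 ^ l = a * 2 ^ k * 2 ^ (l - k)" by (simp only: mult.assoc)
  also have "\<dots> \<in> \<int>" by (intro Ints_mult assms(1)) simp
  finally show ?thesis .
qed

lemma lft_dyadic: "lft c i * 2 ^ lev c i \<in> \<int>"
  and rgt_dyadic: "rgt c i * 2 ^ lev c i \<in> \<int>"
proof -
  have rl: "rgt c i * 2 ^ lev c i = lft c i * 2 ^ lev c i + 1" for i
    by (simp add: rgt_def field_simps)
  show *: "lft c i * 2 ^ lev c i \<in> \<int>"
  proof (induction i)
    case (Suc i)
    show ?case
    proof (cases "c i")
      case True
      then show ?thesis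
        using dyadic_scale_up[OF Suc, of "Suc (lev c i)"] by (simp add: lft_Suc_True lev_Suc_True)
    next
      case False
      have "rgt c i * 2 ^ lev c i \<in> \<int>" using Suc by (simp add: rl)
      then show ?thesis
        unfolding lft_Suc_False[of c, OF False] lev_Suc_False[of c, OF False] by (rule LeastI)
    qed
  qed simp
  show "rgt c i * 2 ^ lev c i \<in> \<int>" using * by (simp add: rl)
qed

lemma dyadic_gap:
  fixes a b :: real
  assumes "a * 2 ^ k \<in> \<int>" "b * 2 ^ k \<in> \<int>" "a < b"
  shows "a + 1 / 2 ^ k \<le> b"
proof -
  obtain p q where pq: "a * 2 ^ k = of_int p" "b * 2 ^ k = of_int q"
    using assms(1,2) by (auto elim!: Ints_cases)
  have "a * 2 ^ k < b * 2 ^ k" using assms(3) by simp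
  then have "p + 1 \<le> q" by (simp add: pq)
  then have "a * 2 ^ k + 1 \<le> b * 2 ^ k" by (simp add: pq)
  then show ?thesis by (simp add: field_simps)
qed

text \<open>The delicate case is a skip inside the interval of stage \<open>j\<close>: the longest
  dyadic interval at the new left endpoint must not stick out.\<close>

lemma dyad_nested:
  assumes "j < i"
  shows "rgt c j \<le> lft c i \<or>
    lev c j < lev c i \<and> lft c j \<le> lft c i \<and> rgt c i \<le> rgt c j"
  using Suc_leI[OF assms]
proof (induction i rule: dec_induct)
  case base
  show ?case
    by (cases "c j") (auto simp: lft_Suc_True lev_Suc_True lft_Suc_False rgt_def field_simps)
next
  case (step i)
  show ?case
  proof (cases "rgt c j \<le> lft c i")
    case True
    then show ?thesis using lft_mono[of i "Suc i" c] by auto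
  next
    case False
    then have I: "lev c j < lev c i" "lft c j \<le> lft c i" "rgt c i \<le> rgt c j"
      using step.IH by auto
    show ?thesis
    proof (cases "c i")
      case True
      have "1 / 2 ^ Suc (lev c i) \<le> (1 / 2 ^ lev c i :: real)" by (simp add: field_simps)
      then have "rgt c (Suc i) \<le> rgt c i"
        using True by (simp add: rgt_def lft_Suc_True lev_Suc_True)
      then show ?thesis using I True by (auto simp: lft_Suc_True lev_Suc_True)
    next
      case skip: False
      let ?b = "rgt c i"
      show ?thesis
      proof (cases "?b = rgt c j")
        case True
        then show ?thesis using skip by (simp add: lft_Suc_False)
      next
        case False
        then have lt: "lft c j < ?b" "?b < rgt c j"
          using I lft_less_rgt[of c i] by auto
        \<comment> \<open>Otherwise the new left endpoint would be a multiple of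
          \<open>1 / 2 ^ lev c j\<close> strictly inside a dyadic interval of exactly that
          length.\<close>
        have less: "lev c j < lev c (Suc i)"
        proof (rule ccontr)
          assume "\<not> lev c j < lev c (Suc i)"
          then have le: "lev c (Suc i) \<le> lev c j" by simp
          have "?b * 2 ^ lev c (Suc i) \<in> \<int>"
            using lft_dyadic[of c "Suc i"] skip by (simp add: lft_Suc_False)
          from dyadic_scale_up[OF this le] have "?b * 2 ^ lev c j \<in> \<int>" .
          from dyadic_gap[OF lft_dyadic this lt(1)] lt(2) show False
            by (simp add: rgt_def)
        qed
        have "?b + 1 / 2 ^ lev c (Suc i) \<le> rgt c j"
        proof (rule dyadic_gap)
          show "?b * 2 ^ lev c (Suc i) \<in> \<int>"
            using lft_dyadic[of c "Suc i"] skip by (simp add: lft_Suc_False)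
          show "rgt c j * 2 ^ lev c (Suc i) \<in> \<int>"
            using less by (intro dyadic_scale_up[OF rgt_dyadic]) auto
        qed (use lt in simp)
        then show ?thesis
          using less lt skip by (simp add: rgt_def[of c "Suc i"] lft_Suc_False)
      qed
    qed
  qed
qed

lemma lev_less_if_common:
  assumes "j < i" "lft c i \<le> r" "r < rgt c j"
  shows "lev c j < lev c i" "lft c j \<le> lft c i" "rgt c i \<le> rgt c j"
  using dyad_nested[OF assms(1), of c] assms(2,3) by auto

text \<open>A particle shifted infinitely often lies in ever shorter intervals. Those around the
  larger point eventually start to the right of the smaller one, and left endpoints never go
  back.\<close>

lemma infinite_moves_unique:
  assumes "infinite (moves c r)" "infinite (moves c s)"
  shows "r = s"
proof -
  have False if "r < s" and inf: "infinite (moves c r)" "infinite (moves c s)" for r s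
  proof -
    have ge: "\<exists>j\<in>moves c s. m \<le> lev c j" for m
    proof (induction m)
      case 0
      then show ?case using inf(2) by (metis finite.emptyI le0 ex_in_conv)
    next
      case (Suc m)
      then obtain j where j: "j \<in> moves c s" "m \<le> lev c j" by blast
      obtain i where i: "i \<in> moves c s" "j < i"
        using inf(2) by (meson infinite_nat_iff_unbounded)
      have "lev c j < lev c i"
        using i j by (intro lev_less_if_common[of j i c s]) (auto simp: moves_def)
      then show ?case using i j by (intro bexI[of _ i]) auto
    qed
    obtain m where m: "1 / 2 ^ m < s - r"
      using real_arch_pow_inv[of "s - r" "1/2"] \<open>r < s\<close> by (auto simp: power_one_over)
    obtain j where j: "j \<in> moves c s" "m \<le> lev c j" using ge by blast
    have "1 / 2 ^ lev c j \<le> (1 / 2 ^ m :: real)"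
      using j(2) by (simp add: frac_le)
    then have "r < lft c j"
      using j m by (auto simp: moves_def rgt_def)
    obtain i where i: "i \<in> moves c r" "j < i"
      using inf(1) by (meson infinite_nat_iff_unbounded)
    then have "lft c j \<le> lft c i" by (intro lft_mono) auto
    then show False using i \<open>r < lft c j\<close> by (auto simp: moves_def)
  qed
  then show ?thesis using assms by (meson linorder_neqE)
qed

text \<open>Before its last shift a particle lies in the same intervals as the left endpoint of the
  interval of that shift.\<close>

lemma moves_finite_Max:
  assumes "finite (moves c r)" "i \<in> moves c r" "\<And>j. j \<in> moves c r \<Longrightarrow> j \<le> i"
  shows "moves c r = insert i (past c i)"
proof -
  have "j \<in> moves c r \<longleftrightarrow> j \<in> moves c (lft c i)" if "j < i" for j
    using dyad_nested[OF that, of c] assms(2) lft_mono[of j i c] that lft_less_rgt[of c i]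
    by (auto simp: moves_def)
  then show ?thesis
    using assms(2,3) by (auto simp: past_def order.order_iff_strict)
qed

section \<open>The spine of an unfinished traversal\<close>

lemma spine_imp_step:
  assumes "j \<in> spine c"
  shows "c j"
proof (rule ccontr)
  assume "\<not> c j"
  then have "lft c (Suc j) = rgt c j" by (rule lft_Suc_False)
  then show False using assms by (auto simp: spine_def dest: spec[of _ "Suc j"])
qed

text \<open>An earlier interval still open at a stage \<open>i \<ge> j\<close> contains that of the
  spine stage \<open>j\<close>, which is never left; so it is never left either.\<close>

lemma past_eq_spine:
  assumes "j \<in> spine c" "l < j" "j \<le> i"
  shows "l \<in> past c i \<longleftrightarrow> l \<in> spine c"
proof
  assume "l \<in> spine c"
  then have "c l" "lft c i < rgt c l"
    using spine_imp_step assms by (auto simp: spine_def)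
  then show "l \<in> past c i"
    using assms lft_mono[of l i c] by (auto simp: past_def moves_def)
next
  assume "l \<in> past c i"
  then have l: "lft c i < rgt c l" by (auto simp: past_def moves_def)
  have "lft c j < rgt c l" using l lft_mono[of j i c] assms by auto
  then have jl: "rgt c j \<le> rgt c l" using dyad_nested[of l j c] assms by auto
  show "l \<in> spine c"
    unfolding spine_def
  proof (intro CollectI allI impI)
    fix m assume "l < m"
    show "lft c m < rgt c l"
    proof (cases "m \<le> j")
      case True
      then show ?thesis using lft_mono[of m j c] \<open>lft c j < rgt c l\<close> by auto
    next
      case False
      then have "lft c m < rgt c j" using assms(1) by (auto simp: spine_def)
      then show ?thesis using jl by simp
    qed
  qed
qed

text \<open>After a spine stage, the left half is the next one if it is never left; otherwise the
  stage arriving at the midpoint is on the spine.\<close>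

lemma spine_infinite:
  assumes "\<And>i. lft c i < 1"
  shows "infinite (spine c)"
proof -
  have zero: "0 \<in> spine c" using assms by (simp add: spine_def)
  have next_ex: "\<exists>i>j. i \<in> spine c" if j: "j \<in> spine c" for j
  proof (cases "Suc j \<in> spine c")
    case False
    let ?mid = "rgt c (Suc j)"
    have cj: "c j" using j by (rule spine_imp_step)
    then have mid: "?mid = lft c j + 1 / 2 ^ Suc (lev c j)"
      by (simp add: rgt_def lft_Suc_True lev_Suc_True)
    define i where "i = (LEAST i. ?mid \<le> lft c i)"
    have ex: "\<exists>i. ?mid \<le> lft c i" using False by (auto simp: spine_def not_less)
    have i: "?mid \<le> lft c i" unfolding i_def using ex by (rule LeastI_ex)
    have below: "lft c l < ?mid" if "l < i" for l
      using not_less_Least[of l "\<lambda>i. ?mid \<le> lft c i"] that by (auto simp: i_def)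
    have "Suc j < i"
    proof (rule ccontr)
      assume "\<not> Suc j < i"
      then have "lft c i \<le> lft c (Suc j)" by (intro lft_mono) auto
      then show False using i lft_less_rgt[of c "Suc j"] by auto
    qed
    then obtain i' where i': "i = Suc i'" "Suc j \<le> i'" by (cases i) auto
    have lt: "lft c i' < ?mid" using below i' by simp
    then have skip: "\<not> c i'" using i i' by (auto simp: lft_Suc_True)
    have "rgt c i' \<le> ?mid"
      using dyad_nested[of "Suc j" i' c] i' lt by (cases "i' = Suc j") auto
    then have eq: "lft c i = ?mid" "rgt c i' = ?mid"
      using i skip by (auto simp: i' lft_Suc_False)
    \<comment> \<open>As the midpoint is a multiple of \<open>1 / 2 ^ lev c (Suc j)\<close>, the
      \<open>LEAST\<close> picks an interval at least as long as the right half; leaving it means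
      leaving the interval of \<open>j\<close>.\<close>
    have "?mid * 2 ^ lev c (Suc j) \<in> \<int>" by (rule rgt_dyadic)
    then have "lev c i \<le> lev c (Suc j)"
      using skip by (simp add: i' lev_Suc_False Least_le flip: eq(2))
    then have "1 / 2 ^ Suc (lev c j) \<le> (1 / 2 ^ lev c i :: real)"
      using cj by (simp add: frac_le lev_Suc_True del: power_Suc)
    then have "rgt c j \<le> rgt c i"
      by (simp add: rgt_def[of c i] eq mid) (simp add: rgt_def field_simps)
    moreover have "lft c l < rgt c j" if "i < l" for l
      using j \<open>Suc j < i\<close> that by (auto simp: spine_def)
    ultimately have "i \<in> spine c"
      by (auto simp: spine_def intro: less_le_trans)
    then show ?thesis using \<open>Suc j < i\<close> by (intro exI[of _ i]) auto
  qed auto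
  have "\<exists>i>m. i \<in> spine c" for m
  proof (induction m)
    case 0
    show ?case using next_ex[OF zero] .
  next
    case (Suc m)
    then obtain i where "i > m" "i \<in> spine c" by blast
    then obtain k where "i < k" "k \<in> spine c" using next_ex by blast
    then show ?case using \<open>i > m\<close> by (intro exI[of _ k]) auto
  qed
  then show ?thesis by (auto simp: infinite_nat_iff_unbounded)
qed

lemma past_tendsto_spine:
  assumes "labelling d" "infinite (spine c)"
  shows "(\<lambda>i. ssum d (past c i)) \<longlonglongrightarrow> ssum d (spine c)"
    and "(\<lambda>i. ssum d (insert i (past c i))) \<longlonglongrightarrow> ssum d (spine c)"
proof -
  have ev: "\<forall>\<^sub>F i in sequentially. l < i \<and> (l \<in> past c i \<longleftrightarrow> l \<in> spine c)" for l
  proof -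
    obtain j where "j \<in> spine c" "l < j"
      using assms(2) by (meson infinite_nat_iff_unbounded)
    then show ?thesis
      by (auto simp: eventually_sequentially past_eq_spine intro!: exI[of _ j])
  qed
  show "(\<lambda>i. ssum d (past c i)) \<longlonglongrightarrow> ssum d (spine c)"
    by (rule tendsto_ssum[OF assms(1)], rule eventually_mono[OF ev]) auto
  show "(\<lambda>i. ssum d (insert i (past c i))) \<longlonglongrightarrow> ssum d (spine c)"
    by (rule tendsto_ssum[OF assms(1)], rule eventually_mono[OF ev]) auto
qed

text \<open>In an unfinished traversal the positions at spine stages lie in \<open>D\<close> and
  converge to an irrational number, which contradicts closedness of \<open>D\<close>. So the
  traversal passes \<open>r\<close>, and it does so at a position outside \<open>D\<close>.\<close>

lemma exit_closed:
  assumes d: "labelling d" and "c 0" and D: "closed D" "D \<subseteq> \<rat>"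
    and strat: "\<And>i. 0 < i \<Longrightarrow> c i \<longleftrightarrow> z + ssum d (past c i) \<in> D"
    and z: "z \<in> \<rat>" and r: "0 \<le> r" "r < 1"
  shows "z + ssum d (moves c r) \<notin> D"
proof -
  have "\<exists>i. 1 \<le> lft c i"
  proof (rule ccontr)
    assume "\<not> ?thesis"
    then have inf: "infinite (spine c)" by (intro spine_infinite) (simp add: not_le)
    let ?p = "z + ssum d (spine c)"
    have lim: "(\<lambda>i. z + ssum d (past c i)) \<longlonglongrightarrow> ?p"
      by (intro tendsto_intros past_tendsto_spine d inf)
    \<comment> \<open>Stage 0 is removed since its move is forced and says nothing about
      \<open>D\<close>.\<close>
    let ?S = "spine c - {0}"
    have S: "infinite ?S" using inf by simp
    have sub: "(\<lambda>k. z + ssum d (past c (enumerate ?S k))) \<longlonglongrightarrow> ?p"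
      using LIMSEQ_subseq_LIMSEQ[OF lim strict_mono_enumerate[OF S]] by (simp add: o_def)
    have "z + ssum d (past c (enumerate ?S k)) \<in> D" for k
      using enumerate_in_set[OF S, of k] strat spine_imp_step by blast
    then have "?p \<in> D" using closed_sequentially[OF D(1) _ sub] by blast
    then have "?p - z \<in> \<rat>" using D(2) z by (intro Rats_diff) auto
    then show False using ssum_infinite_irrational[OF d inf] by simp
  qed
  then obtain J where J: "r < lft c J" using r by (auto intro: less_le_trans)
  \<comment> \<open>The last stage whose interval contains \<open>r\<close>. It is a skip, so its
    past lists all shifts of \<open>r\<close>.\<close>
  define i where "i = (LEAST i. r < lft c (Suc i))"
  have ex: "\<exists>i. r < lft c (Suc i)" using J r by (cases J) auto
  have i: "r < lft c (Suc i)" unfolding i_def using ex by (rule LeastI_ex)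
  have le: "lft c i \<le> r"
  proof (cases i)
    case (Suc k)
    then show ?thesis
      using not_less_Least[of k "\<lambda>i. r < lft c (Suc i)"] by (auto simp: i_def)
  qed (use r in simp)
  have skip: "\<not> c i" using i le by (auto simp: lft_Suc_True)
  then have ri: "r < rgt c i" using i by (simp add: lft_Suc_False)
  have "0 < i" using skip \<open>c 0\<close> by (cases i) auto
  have "moves c r = past c i"
  proof (intro set_eqI iffI)
    fix j assume j: "j \<in> moves c r"
    have "j < i"
    proof (rule ccontr)
      assume "\<not> j < i"
      then consider "j = i" | "Suc i \<le> j" by linarith
      then have "j = i \<or> lft c (Suc i) \<le> lft c j" by cases (auto intro: lft_mono)
      then show False using j skip i by (auto simp: moves_def)
    qed
    then show "j \<in> past c i"
      using j le by (auto simp: past_def moves_def lft_mono)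
  next
    fix j assume j: "j \<in> past c i"
    then have "rgt c i \<le> rgt c j" "c j" "j < i"
      using dyad_nested[of j i c] by (auto simp: past_def moves_def)
    then show "j \<in> moves c r"
      using ri le lft_mono[of j i c] by (auto simp: moves_def)
  qed
  then show ?thesis using strat[OF \<open>0 < i\<close>] skip by simp
qed

subsection \<open>The family of measures\<close>

text \<open>In binary, the digits 11 followed by the first \<open>t\<close> bits of
  \<open>x\<close>, so that both \<open>t\<close> and the bits can be recovered. The initial 3 also
  gives the bound in \<open>labelling\<close>.\<close>

primrec history_code :: "(nat \<Rightarrow> bool) \<Rightarrow> nat \<Rightarrow> nat" where
  "history_code x 0 = 3"
| "history_code x (Suc t) = 2 * history_code x t + of_bool (x t)"

text \<open>Bit \<open>j\<close> of process \<open>n\<close> is read at time \<open>prod_encode (n, j)\<close>, so that all processes run in parallel.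
  The first move is forced: it carries the process away from \<open>n\<close>, which would otherwise
  be a common point of all supports.\<close>
definition bits :: "(nat \<Rightarrow> bool) \<Rightarrow> nat \<Rightarrow> nat \<Rightarrow> bool" where
  "bits x n j \<longleftrightarrow> j = 0 \<or> x (prod_encode (n, j))"

definition lab :: "(nat \<Rightarrow> bool) \<Rightarrow> nat \<Rightarrow> nat \<Rightarrow> nat" where
  "lab x n j = history_code x (prod_encode (n, j))"

text \<open>Common position of the current block before the decision at stage \<open>i\<close>;
  \<open>node\<close> is its position after a shift at that stage.\<close>

definition place :: "(nat \<Rightarrow> bool) \<Rightarrow> nat \<Rightarrow> nat \<Rightarrow> real" where
  "place x n i = real n + ssum (lab x n) (past (bits x n) i)"

definition node :: "(nat \<Rightarrow> bool) \<Rightarrow> nat \<Rightarrow> nat \<Rightarrow> real" where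
  "node x n i = real n + ssum (lab x n) (insert i (past (bits x n) i))"

text \<open>Final position of the particle \<open>w\<close>. Negative particles join process 0
  through \<open>nat\<close>.\<close>

definition pos :: "(nat \<Rightarrow> bool) \<Rightarrow> real \<Rightarrow> real" where
  "pos x w = real (nat \<lfloor>w\<rfloor>) +
     ssum (lab x (nat \<lfloor>w\<rfloor>)) (moves (bits x (nat \<lfloor>w\<rfloor>)) (frac w))"

lemma prod_encode_less: "i < j \<Longrightarrow> prod_encode (n, i) < prod_encode (n, j)"
proof (induction j rule: less_Suc_induct)
  case (1 i)
  then show ?case by (simp add: prod_encode_def)
qed auto

lemma bits_0 [simp]: "bits x n 0"
  by (simp add: bits_def)

lemma history_code_cong: "(\<And>s. s < t \<Longrightarrow> x s = y s) \<Longrightarrow> history_code x t = history_code y t"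
  by (induction t) auto

lemma history_code_ge: "3 \<le> history_code x t"
  by (induction t) auto

lemma history_code_mono: "strict_mono (history_code x)"
proof (unfold strict_mono_Suc_iff, intro allI)
  fix t
  show "history_code x t < history_code x (Suc t)" using history_code_ge[of x t] by simp
qed

text \<open>Parity recovers the last bit and halving goes back one step; codes at positive times are
  at least 6, so both descents end together.\<close>

lemma history_code_eqD: "history_code x t = history_code y u \<Longrightarrow> t = u \<and> (\<forall>s<t. x s = y s)"
proof (induction t arbitrary: u)
  case 0
  then show ?case using history_code_ge[of y "u - 1"] by (cases u) auto
next
  case (Suc t)
  show ?case
  proof (cases u)
    case 0
    then show ?thesis using Suc.prems history_code_ge[of x t] by auto
  next
    case u: (Suc v)
    have eq: "2 * history_code x t + of_bool (x t) = 2 * history_code y v + of_bool (y v)"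
      using Suc.prems u by simp
    then have "x t = y v" "history_code x t = history_code y v"
      by (auto simp: of_bool_def split: if_splits) presburger+
    then show ?thesis using Suc.IH[of v] u by (auto simp: less_Suc_eq)
  qed
qed

lemma labelling_lab: "labelling (lab x n)"
  unfolding labelling_def lab_def strict_mono_def
  using history_code_mono[of x] history_code_ge[of x] prod_encode_less by (auto simp: strict_mono_def)

lemma dyad_cong: "(\<And>j. j < i \<Longrightarrow> c j = c' j) \<Longrightarrow> dyad c i = dyad c' i"
  by (induction i) auto

lemma lft_rgt_cong:
  assumes "\<And>j. j < i \<Longrightarrow> c j = c' j"
  shows "lft c i = lft c' i" "rgt c i = rgt c' i"
  using dyad_cong[OF assms] by (simp_all add: lft_def rgt_def lev_def)

lemma past_cong:
  assumes "\<And>j. j < i \<Longrightarrow> c j = c' j"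
  shows "past c i = past c' i"
proof -
  have *: "lft c j = lft c' j" "rgt c j = rgt c' j" if "j \<le> i" for j
    using that assms by (auto intro!: lft_rgt_cong)
  show ?thesis
    unfolding past_def moves_def using * assms by (auto simp: less_imp_le)
qed

lemma ssum_cong: "(\<And>j. j \<in> S \<Longrightarrow> d j = d' j) \<Longrightarrow> ssum d S = ssum d' S"
  unfolding ssum_def by (intro suminf_cong) auto

text \<open>Only shifts before stage \<open>i\<close> enter, and they are determined by earlier
  bits. Hence a decision may be prescribed in terms of the current position.\<close>

lemma place_cong:
  assumes "\<And>s. s < prod_encode (n, i) \<Longrightarrow> x s = y s"
  shows "place x n i = place y n i"
proof -
  have le: "j \<le> i \<Longrightarrow> prod_encode (n, j) \<le> prod_encode (n, i)" for j
    using prod_encode_less[of j i n] by (cases "j = i") auto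
  have "past (bits x n) i = past (bits y n) i"
    using assms prod_encode_less by (intro past_cong) (auto simp: bits_def)
  moreover have "lab x n j = lab y n j" if "j \<le> i" for j
    unfolding lab_def using le[OF that] assms by (intro history_code_cong) auto
  then have "ssum (lab x n) (past (bits y n) i) = ssum (lab y n) (past (bits y n) i)"
    by (intro ssum_cong) (auto simp: past_def)
  ultimately show ?thesis by (simp add: place_def)
qed

text \<open>Whether stage \<open>j\<close> shifts \<open>w\<close>, and by how much, is settled by
  finitely many bits.\<close>

lemma pos_tendsto:
  assumes "\<And>t. \<forall>\<^sub>F k in sequentially. X k t = x t"
  shows "(\<lambda>k. pos (X k) w) \<longlonglongrightarrow> pos x w"
proof -
  define n where "n = nat \<lfloor>w\<rfloor>"
  have "\<forall>\<^sub>F k in sequentially.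
      (j \<in> moves (bits (X k) n) (frac w) \<longleftrightarrow> j \<in> moves (bits x n) (frac w)) \<and>
      lab (X k) n j = lab x n j" for j
  proof -
    have "\<forall>\<^sub>F k in sequentially. \<forall>t\<in>{..prod_encode (n, j)}. X k t = x t"
      using assms by (intro eventually_ball_finite) auto
    then show ?thesis
    proof eventually_elim
      case (elim k)
      have b: "bits (X k) n i = bits x n i" if "i \<le> j" for i
        using elim prod_encode_less[of i j n] that
        by (cases "i = j") (auto simp: bits_def)
      then have "lft (bits (X k) n) j = lft (bits x n) j" "rgt (bits (X k) n) j = rgt (bits x n) j"
        by (auto intro!: lft_rgt_cong)
      moreover have "lab (X k) n j = lab x n j"
        unfolding lab_def using elim by (intro history_code_cong) auto
      ultimately show ?case using b[of j] by (simp add: moves_def)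
    qed
  qed
  then have "(\<lambda>k. ssum (lab (X k) n) (moves (bits (X k) n) (frac w))) \<longlonglongrightarrow>
      ssum (lab x n) (moves (bits x n) (frac w))"
    by (rule tendsto_ssum[OF labelling_lab])
  then show ?thesis
    unfolding pos_def n_def[symmetric] by (intro tendsto_intros)
qed

lemma pos_measurable [measurable]: "pos x \<in> borel_measurable borel"
proof -
  have [measurable]: "(frac :: real \<Rightarrow> real) \<in> borel_measurable borel"
    unfolding frac_def[abs_def] by measurable
  have [measurable]: "(\<lambda>w::real. nat \<lfloor>w\<rfloor>) \<in> measurable borel (count_space UNIV)"
    by measurable
  have "(\<lambda>w. real n + ssum (lab x n) (moves (bits x n) (frac w))) \<in> borel_measurable borel" for n
    unfolding ssum_def moves_def mem_Collect_eq of_bool_def by measurable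
  then have "(\<lambda>w. (\<lambda>n w. real n + ssum (lab x n) (moves (bits x n) (frac w))) (nat \<lfloor>w\<rfloor>) w)
      \<in> borel_measurable borel"
    by (rule measurable_compose_countable) measurable
  then show ?thesis unfolding pos_def[abs_def] .
qed

lemma pos_Rats_iff: "pos x w \<in> \<rat> \<longleftrightarrow> finite (moves (bits x (nat \<lfloor>w\<rfloor>)) (frac w))"
proof
  assume "pos x w \<in> \<rat>"
  then have "pos x w - real (nat \<lfloor>w\<rfloor>) \<in> \<rat>" by (intro Rats_diff) auto
  then show "finite (moves (bits x (nat \<lfloor>w\<rfloor>)) (frac w))"
    using ssum_infinite_irrational[OF labelling_lab] by (auto simp: pos_def)
qed (auto simp: pos_def intro!: Rats_add ssum_finite_Rats)

section \<open>Laws as images of the Gaussian measure\<close>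

abbreviation gauss :: "real measure" where
  "gauss \<equiv> density lborel std_normal_density"

lemma prob_space_gauss: "prob_space gauss"
  by (rule prob_space_normal_density) simp

lemma AE_gauss_countable:
  assumes "countable B"
  shows "AE w in gauss. w \<notin> B"
proof -
  have "AE w in lborel. w \<notin> B"
    using assms by (intro AE_not_in countable_imp_null_set_lborel)
  then have "AE w in lborel. 0 < ennreal (std_normal_density w) \<longrightarrow> w \<notin> B"
    by eventually_elim simp
  then show ?thesis by (subst AE_density) auto
qed

text \<open>A lower bound for the share of process \<open>n\<close>; for \<open>n = 0\<close> the
  negative particles are not counted.\<close>

definition mass :: "nat \<Rightarrow> real" where
  "mass n = measure gauss {real n..<real n + 1}"

lemma mass_pos: "0 < mass n"
proof (rule ccontr)
  interpret prob_space gauss by (rule prob_space_gauss)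
  assume "\<not> 0 < mass n"
  then have "emeasure gauss {real n..<real n + 1} = 0"
    by (simp add: mass_def emeasure_eq_measure not_less measure_le_0_iff)
  then have "AE w in gauss. w \<notin> {real n..<real n + 1}"
    by (intro AE_not_in) (auto simp: null_sets_def)
  then have "AE w in lborel. w \<notin> {real n..<real n + 1}"
    by (subst (asm) AE_density) (auto simp: normal_density_pos)
  then have "emeasure lborel {real n..<real n + 1} = 0"
    by (subst (asm) AE_iff_measurable[of "{real n..<real n + 1}"]) auto
  then show False by simp
qed

text \<open>By \<open>infinite_moves_unique\<close> each process has at most one bad fractional
  part, so the bad particles form a countable set.\<close>

lemma AE_pos_Rats: "AE w in gauss. pos x w \<in> \<rat>"
proof -
  define R where "R = {r. \<exists>n. infinite (moves (bits x n) r)}"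
  have "R \<subseteq> range (\<lambda>n. SOME r. infinite (moves (bits x n) r))"
  proof
    fix r assume "r \<in> R"
    then obtain n where n: "infinite (moves (bits x n) r)" by (auto simp: R_def)
    then have "infinite (moves (bits x n) (SOME r. infinite (moves (bits x n) r)))"
      by (rule someI)
    then have "r = (SOME r. infinite (moves (bits x n) r))"
      by (rule infinite_moves_unique[OF n])
    then show "r \<in> range (\<lambda>n. SOME r. infinite (moves (bits x n) r))" by blast
  qed
  then have "countable R" by (rule countable_subset) simp
  then have "countable ((\<lambda>(z, r). real_of_int z + r) ` (UNIV \<times> R))" by simp
  then have "AE w in gauss. w \<notin> (\<lambda>(z, r). real_of_int z + r) ` (UNIV \<times> R)"
    by (rule AE_gauss_countable)
  then show ?thesis
  proof eventually_elim
    case (elim w)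
    show ?case
    proof (rule ccontr)
      assume "pos x w \<notin> \<rat>"
      then have "frac w \<in> R" by (auto simp: pos_Rats_iff R_def)
      moreover have "w = real_of_int \<lfloor>w\<rfloor> + frac w" by (simp add: frac_def)
      ultimately have "w \<in> (\<lambda>(z, r). real_of_int z + r) ` (UNIV \<times> R)"
        by (intro image_eqI[of _ _ "(\<lfloor>w\<rfloor>, frac w)"]) auto
      then show False using elim by blast
    qed
  qed
qed

text \<open>The value \<open>0\<close> is taken only on a null set, by \<open>AE_pos_Rats\<close>.\<close>
definition rpos :: "(nat \<Rightarrow> bool) \<Rightarrow> real \<Rightarrow> real" where
  "rpos x w = (if pos x w \<in> \<rat> then pos x w else 0)"

definition law :: "(nat \<Rightarrow> bool) \<Rightarrow> real measure" where
  "law x = distr gauss (restrict_space borel \<rat>) (rpos x)"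

lemma Rats_borel [measurable]: "\<rat> \<in> sets (borel :: real measure)"
  by (rule sets.countable) (auto simp: countable_rat)

lemma rpos_measurable [measurable]: "rpos x \<in> measurable gauss (restrict_space borel \<rat>)"
proof (rule measurable_restrict_space2)
  show "rpos x \<in> space gauss \<rightarrow> \<rat>" by (auto simp: rpos_def)
  show "rpos x \<in> measurable gauss borel" unfolding rpos_def[abs_def] by measurable
qed

lemma law_in_prob_rats: "law x \<in> prob_rats"
  unfolding prob_rats_def law_def
  using prob_space.prob_space_distr[OF prob_space_gauss rpos_measurable] by simp

lemma integral_law_tendsto:
  fixes f :: "real \<Rightarrow> real"
  assumes X: "\<And>t. \<forall>\<^sub>F k in sequentially. X k t = x t"
    and f: "continuous_on \<rat> f" "bounded (f ` \<rat>)"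
  shows "(\<lambda>k. \<integral>w. f w \<partial>law (X k)) \<longlonglongrightarrow> (\<integral>w. f w \<partial>law x)"
proof -
  interpret prob_space gauss by (rule prob_space_gauss)
  have fm [measurable]: "f \<in> borel_measurable (restrict_space borel \<rat>)"
    by (rule borel_measurable_continuous_on_restrict[OF f(1)])
  obtain C where C: "\<And>q. q \<in> \<rat> \<Longrightarrow> \<bar>f q\<bar> \<le> C"
    using f(2) by (auto simp: bounded_iff)
  have eq: "(\<integral>w. f w \<partial>law y) = (\<integral>w. f (rpos y w) \<partial>gauss)" for y
    unfolding law_def by (rule integral_distr) measurable
  have "(\<lambda>k. \<integral>w. f (rpos (X k) w) \<partial>gauss) \<longlonglongrightarrow> (\<integral>w. f (rpos x w) \<partial>gauss)"
  proof (rule integral_dominated_convergence[where w = "\<lambda>_. C"])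
    \<comment> \<open>As \<open>f\<close> is continuous on \<rat> only, one null set must take care
      of all \<open>k\<close>.\<close>
    have "AE w in gauss. \<forall>k. pos (X k) w \<in> \<rat>"
      by (simp only: AE_all_countable AE_pos_Rats simp_thms)
    with AE_pos_Rats[of x]
    show "AE w in gauss. (\<lambda>k. f (rpos (X k) w)) \<longlonglongrightarrow> f (rpos x w)"
    proof eventually_elim
      case (elim w)
      have "(\<lambda>k. f (pos (X k) w)) \<longlonglongrightarrow> f (pos x w)"
        using elim by (intro continuous_on_tendsto_compose[OF f(1) pos_tendsto[OF X]]) auto
      then show ?case using elim by (simp add: rpos_def)
    qed
    show "AE w in gauss. norm (f (rpos (X k) w)) \<le> C" for k
      by (intro AE_I2) (auto simp: rpos_def intro: C)
  qed auto
  then show ?thesis by (simp add: eq)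
qed

lemma mass_le_law:
  assumes "B \<in> sets (restrict_space borel \<rat>)"
    and "\<And>w. nat \<lfloor>w\<rfloor> = n \<Longrightarrow> pos x w \<in> \<rat> \<Longrightarrow> pos x w \<in> B"
  shows "mass n \<le> measure (law x) B"
proof -
  interpret prob_space gauss by (rule prob_space_gauss)
  have "mass n \<le> measure gauss (rpos x -` B \<inter> space gauss)"
    unfolding mass_def
  proof (rule finite_measure_mono_AE)
    show "AE w in gauss. w \<in> {real n..<real n + 1} \<longrightarrow> w \<in> rpos x -` B \<inter> space gauss"
      using AE_pos_Rats[of x]
    proof eventually_elim
      case (elim w)
      show ?case
      proof
        assume "w \<in> {real n..<real n + 1}"
        then have "\<lfloor>w\<rfloor> = int n" by (auto simp: floor_eq_iff)
        then have "pos x w \<in> B" using assms(2) elim by simp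
        then show "w \<in> rpos x -` B \<inter> space gauss" using elim by (simp add: rpos_def)
      qed
    qed
    show "rpos x -` B \<inter> space gauss \<in> events"
      using assms(1) by (rule measurable_sets[OF rpos_measurable])
  qed
  also have "\<dots> = measure (law x) B"
    unfolding law_def by (rule measure_distr[symmetric, OF rpos_measurable assms(1)])
  finally show ?thesis .
qed

subsection \<open>Escaping from a compact set\<close>

definition follows :: "(nat \<Rightarrow> bool) \<Rightarrow> nat \<Rightarrow> real set \<Rightarrow> bool" where
  "follows x n D \<longleftrightarrow> (\<forall>j. x (prod_encode (n, j)) \<longleftrightarrow> place x n j \<in> D)"

text \<open>\<open>exit_closed\<close> applies to every particle of process \<open>n\<close>; the
  forced first move of \<open>bits\<close> matches its hypothesis on stage 0.\<close>

lemma follows_imp_mass: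
  assumes "follows x n D" "compact D" "D \<subseteq> \<rat>"
  shows "mass n \<le> measure (law x) (\<rat> - D)"
proof (rule mass_le_law)
  have "closed D" using assms(2) by (rule compact_imp_closed)
  then show "\<rat> - D \<in> sets (restrict_space borel \<rat>)"
    by (subst sets_restrict_space_iff) auto
  fix w :: real assume n: "nat \<lfloor>w\<rfloor> = n" and "pos x w \<in> \<rat>"
  have "real n + ssum (lab x n) (moves (bits x n) (frac w)) \<notin> D"
    using assms \<open>closed D\<close>
    by (intro exit_closed) (auto simp: labelling_lab bits_def follows_def place_def frac_lt_1)
  then show "pos x w \<in> \<rat> - D" using \<open>pos x w \<in> \<rat>\<close> n by (simp add: pos_def)
qed

subsection \<open>Compactness\<close>

text \<open>\<open>bool\<close> carries its order topology, in which both singletons are open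
  rays.\<close>

lemma open_bool_singleton: "open {b :: bool}"
proof (cases b)
  case True
  then have "{b} = {False<..}" by auto
  then show ?thesis by simp
next
  case False
  then have "{b} = {..<True}" by auto
  then show ?thesis by simp
qed

lemma open_bool_seq_iff:
  fixes U :: "(nat \<Rightarrow> bool) set"
  shows "open U \<longleftrightarrow> (\<forall>x\<in>U. \<exists>N. \<forall>y. (\<forall>s<N. y s = x s) \<longrightarrow> y \<in> U)"
proof (intro iffI ballI)
  fix x assume "open U" "x \<in> U"
  then obtain X where X: "x \<in> (\<Pi>\<^sub>E i\<in>UNIV. X i)" "finite {i. X i \<noteq> UNIV}" "(\<Pi>\<^sub>E i\<in>UNIV. X i) \<subseteq> U"
    using product_topology_open_contains_basis[of "\<lambda>_. euclidean" UNIV U x]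
    by (auto simp: open_fun_def)
  obtain N where N: "\<And>i. X i \<noteq> UNIV \<Longrightarrow> i < N"
    using X(2) by (auto simp: finite_nat_set_iff_bounded)
  have "y \<in> U" if "\<forall>s<N. y s = x s" for y
  proof -
    have "y i \<in> X i" for i using N[of i] that X(1) by (cases "X i = UNIV") (auto simp: PiE_iff)
    then show ?thesis using X(3) by (auto simp: PiE_iff)
  qed
  then show "\<exists>N. \<forall>y. (\<forall>s<N. y s = x s) \<longrightarrow> y \<in> U" by blast
next
  assume *: "\<forall>x\<in>U. \<exists>N. \<forall>y. (\<forall>s<N. y s = x s) \<longrightarrow> y \<in> U"
  show "open U"
  proof (subst open_subopen, intro ballI)
    fix x assume "x \<in> U"
    then obtain N where N: "\<And>y. (\<forall>s<N. y s = x s) \<Longrightarrow> y \<in> U" using * by blast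
    let ?X = "\<lambda>s. if s < N then {x s} else (UNIV :: bool set)"
    have "open (Pi\<^sub>E UNIV ?X)"
      by (rule open_PiE) (auto intro: finite_subset[of _ "{..<N}"] open_bool_singleton)
    moreover have "x \<in> Pi\<^sub>E UNIV ?X" "Pi\<^sub>E UNIV ?X \<subseteq> U"
      using N by (auto simp: PiE_iff split: if_splits)
    ultimately show "\<exists>T. open T \<and> x \<in> T \<and> T \<subseteq> U" by blast
  qed
qed

lemma closed_bool_seq:
  fixes P :: "(nat \<Rightarrow> bool) \<Rightarrow> bool"
  assumes "\<And>x y. (\<And>s. s < N \<Longrightarrow> x s = y s) \<Longrightarrow> P x = P y"
  shows "closed {x. P x}"
  unfolding closed_def open_bool_seq_iff
proof (intro ballI exI[of _ N] allI impI)
  fix x y assume "x \<in> - {x. P x}" "\<forall>s<N. y s = x s"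
  then show "y \<in> - {x. P x}" using assms[of y x] by simp
qed

lemma compact_bool_seq: "compact (UNIV :: (nat \<Rightarrow> bool) set)"
proof -
  have "compact (UNIV :: bool set)" by (rule finite_imp_compact) simp
  then have "compact_space (product_topology (\<lambda>_ :: nat. euclidean :: bool topology) UNIV)"
    unfolding compact_space_product_topology by (simp add: compact_space_def)
  then show ?thesis unfolding euclidean_product_topology by (simp add: compact_space_def)
qed

lemma continuous_map_law: "continuous_map euclidean weak_topology law"
  unfolding weak_topology_def
proof (rule continuous_on_generated_topo)
  fix W
  assume "W \<in> {{\<mu> \<in> prob_rats. (\<integral>x. f x \<partial>\<mu>) \<in> U} | f U.
        continuous_on \<rat> f \<and> bounded (f ` \<rat>) \<and> open (U :: real set)}"
  then obtain f U where W: "W = {\<mu> \<in> prob_rats. (\<integral>x. f x \<partial>\<mu>) \<in> U}"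
    and f: "continuous_on \<rat> f" "bounded (f ` \<rat>)" and U: "open (U :: real set)" by auto
  have "open {x. (\<integral>w. f w \<partial>law x) \<in> U}"
    unfolding open_bool_seq_iff
  proof (intro ballI, rule ccontr)
    fix x assume x: "x \<in> {x. (\<integral>w. f w \<partial>law x) \<in> U}"
    assume "\<not> (\<exists>N. \<forall>y. (\<forall>s<N. y s = x s) \<longrightarrow> y \<in> {x. (\<integral>w. f w \<partial>law x) \<in> U})"
    \<comment> \<open>Counterexamples for all prefix lengths form a sequence converging to
      \<open>x\<close>.\<close>
    then obtain X where X: "\<And>N s. s < N \<Longrightarrow> X N s = x s" "\<And>N. (\<integral>w. f w \<partial>law (X N)) \<notin> U"
      by (auto simp: choice_iff)
    have ev: "\<forall>\<^sub>F N in sequentially. X N t = x t" for t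
      using eventually_gt_at_top[of t] by eventually_elim (rule X(1))
    have "(\<lambda>N. \<integral>w. f w \<partial>law (X N)) \<longlonglongrightarrow> (\<integral>w. f w \<partial>law x)"
      by (rule integral_law_tendsto[OF ev f])
    then have "\<forall>\<^sub>F N in sequentially. (\<integral>w. f w \<partial>law (X N)) \<in> U"
      using U x by (auto dest: topological_tendstoD)
    then show False using X(2) by simp
  qed
  moreover have "law -` W \<inter> topspace euclidean = {x. (\<integral>w. f w \<partial>law x) \<in> U}"
    by (auto simp: W law_in_prob_rats)
  ultimately show "openin euclidean (law -` W \<inter> topspace euclidean)" by simp
next
  show "law ` topspace euclidean \<subseteq> \<Union> {{\<mu> \<in> prob_rats. (\<integral>x. f x \<partial>\<mu>) \<in> U} | f U.
        continuous_on \<rat> f \<and> bounded (f ` \<rat>) \<and> open (U :: real set)}"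
    using law_in_prob_rats topspace_weak_topology
    unfolding weak_topology_def topology_generated_by_topspace by blast
qed

lemma compactin_law_image: "compact Y \<Longrightarrow> compactin weak_topology (law ` Y)"
  by (rule image_compactin[OF _ continuous_map_law]) simp

subsection \<open>Supports\<close>

text \<open>Stages beyond the end of \<open>[0, 1)\<close> carry no particles. Without them a
  process that ends has only finitely many nodes.\<close>

definition nodes :: "(nat \<Rightarrow> bool) \<Rightarrow> nat \<Rightarrow> real set" where
  "nodes x n = {node x n i | i. lft (bits x n) i < 1}"

lemma node_ge: "real n \<le> node x n i"
  by (simp add: node_def ssum_nonneg labelling_lab)

text \<open>Nodes of process \<open>n\<close> are at least \<open>n\<close>, so finitely many
  processes come near \<open>y\<close>. Each has finitely many nodes, or nodes converging to an
  irrational number.\<close>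

lemma nodes_no_limpt:
  assumes "y \<in> \<rat>"
  shows "\<not> y islimpt (\<Union>n. nodes x n)"
proof
  assume y: "y islimpt (\<Union>n. nodes x n)"
  define M where "M = nat \<lceil>y\<rceil> + 1"
  have "\<forall>\<^sub>F z in at y. z \<in> {..<y + 1}"
    by (rule eventually_at_in_open') auto
  from islimpt_Int_eventually[OF y this]
  have "y islimpt (\<Union>n\<in>{..M}. nodes x n)"
  proof (rule islimpt_subset, intro subsetI)
    fix z assume "z \<in> (\<Union>n. nodes x n) \<inter> {..<y + 1}"
    then obtain n where n: "z \<in> nodes x n" "z < y + 1" by auto
    then have "real n \<le> z" using node_ge by (auto simp: nodes_def)
    then have "n \<le> M" using n(2) unfolding M_def by linarith
    then show "z \<in> (\<Union>n\<in>{..M}. nodes x n)" using n by blast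
  qed
  then obtain n where n: "y islimpt nodes x n"
    by (auto simp: islimpt_finite_union_iff)
  show False
  proof (cases "\<exists>J. 1 \<le> lft (bits x n) J")
    case True
    then obtain J where J: "1 \<le> lft (bits x n) J" by blast
    have "i < J" if "lft (bits x n) i < 1" for i
      using that J lft_mono[of J i "bits x n"] by (cases "i < J") auto
    then have "nodes x n \<subseteq> node x n ` {..<J}" by (auto simp: nodes_def)
    then have "finite (nodes x n)" by (rule finite_subset) simp
    then show False using n islimpt_finite by blast
  next
    case False
    then have inf: "infinite (spine (bits x n))" by (intro spine_infinite) (simp add: not_le)
    have "node x n \<longlonglongrightarrow> real n + ssum (lab x n) (spine (bits x n))"
      unfolding node_def[abs_def] by (intro tendsto_intros past_tendsto_spine labelling_lab inf)
    moreover have "y islimpt range (node x n)"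
      using n by (rule islimpt_subset) (auto simp: nodes_def)
    ultimately have "y = real n + ssum (lab x n) (spine (bits x n))"
      by (rule sequence_unique_limpt)
    then have "y - real n = ssum (lab x n) (spine (bits x n))" by simp
    moreover have "y - real n \<in> \<rat>" using assms by (intro Rats_diff) auto
    ultimately show False using ssum_infinite_irrational[OF labelling_lab inf] by metis
  qed
qed

text \<open>An atom is the final position of some particle, whose last shift exhibits it as a
  node.\<close>

lemma atoms_subset_nodes:
  assumes "q \<in> \<rat>" "measure (law x) {q} > 0"
  shows "q \<in> (\<Union>n. nodes x n)"
proof -
  interpret prob_space gauss by (rule prob_space_gauss)
  have q: "{q} \<in> sets (restrict_space borel \<rat>)"
    using assms(1) by (subst sets_restrict_space_iff) auto
  have "measure gauss (rpos x -` {q} \<inter> space gauss) > 0"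
    using assms(2) unfolding law_def by (simp add: measure_distr[OF rpos_measurable q])
  then have "\<not> (AE w in gauss. w \<notin> rpos x -` {q} \<inter> space gauss)"
    using measurable_sets[OF rpos_measurable q, of x] measure_eq_0_null_sets
    by (subst AE_iff_null_sets[symmetric]) force+
  then have "\<not> (AE w in gauss. pos x w \<noteq> q)"
  proof (rule contrapos_nn)
    assume "AE w in gauss. pos x w \<noteq> q"
    with AE_pos_Rats[of x] show "AE w in gauss. w \<notin> rpos x -` {q} \<inter> space gauss"
      by eventually_elim (simp add: rpos_def)
  qed
  then obtain w where w: "pos x w = q" by (auto intro: AE_I2)
  define n where "n = nat \<lfloor>w\<rfloor>"
  let ?c = "bits x n"
  let ?M = "moves ?c (frac w)"
  have fin: "finite ?M" using w assms(1) pos_Rats_iff[of x w] by (simp add: n_def)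
  \<comment> \<open>The forced first move guarantees that a last shift exists.\<close>
  moreover have "0 \<in> ?M" by (simp add: moves_def frac_lt_1)
  ultimately have M: "Max ?M \<in> ?M" by (intro Max_in) auto
  have "?M = insert (Max ?M) (past ?c (Max ?M))"
    by (rule moves_finite_Max[OF fin M]) (simp add: fin)
  then have "q = node x n (Max ?M)" using w by (simp add: pos_def node_def n_def)
  moreover have "lft ?c (Max ?M) < 1"
    using M frac_lt_1[of w] by (auto simp: moves_def)
  ultimately show ?thesis by (auto simp: nodes_def)
qed

text \<open>The closure adds nothing: a point of the support that is no atom would be a rational
  limit point of nodes.\<close>

lemma supp_law_subset: "supp (law x) \<subseteq> \<rat> \<inter> (\<Union>n. nodes x n)"
proof
  fix q assume "q \<in> supp (law x)"
  then have q: "q \<in> \<rat>"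
    and ex: "\<And>T. openin (top_of_set \<rat>) T \<Longrightarrow> q \<in> T \<Longrightarrow> \<exists>y\<in>T. y \<in> \<rat> \<and> measure (law x) {y} > 0"
    by (auto simp: supp_def in_closure_of)
  have "measure (law x) {q} > 0"
  proof (rule ccontr)
    assume q0: "\<not> measure (law x) {q} > 0"
    have "q islimpt (\<Union>n. nodes x n)"
    proof (rule islimptI)
      fix T :: "real set" assume "q \<in> T" "open T"
      then obtain y where "y \<in> T" "y \<in> \<rat>" "measure (law x) {y} > 0"
        using ex[of "\<rat> \<inter> T"] q by auto
      then show "\<exists>y\<in>\<Union>n. nodes x n. y \<in> T \<and> y \<noteq> q"
        using atoms_subset_nodes q0 by (intro bexI[of _ y]) auto
    qed
    then show False using nodes_no_limpt q by blast
  qed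
  then show "q \<in> \<rat> \<inter> (\<Union>n. nodes x n)" using q atoms_subset_nodes by blast
qed

lemma locally_compact_supp_law: "locally compact (supp (law x))"
  unfolding locally_def
proof (intro allI impI)
  fix w q assume w: "openin (top_of_set (supp (law x))) w \<and> q \<in> w"
  then have q: "q \<in> supp (law x)" using openin_imp_subset by blast
  then have "\<not> q islimpt supp (law x)"
    using supp_law_subset[of x] nodes_no_limpt[of q x] islimpt_subset by blast
  then obtain T where T: "open T" "q \<in> T" "\<And>y. y \<in> supp (law x) \<Longrightarrow> y \<in> T \<Longrightarrow> y = q"
    by (auto simp: islimpt_def)
  then have "{q} = supp (law x) \<inter> T" using q T(2,3) by blast
  then have "openin (top_of_set (supp (law x))) {q}"
    using openin_open_Int[OF T(1), of "supp (law x)"] by simp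
  then show "\<exists>u v. openin (top_of_set (supp (law x))) u \<and> compact v \<and> q \<in> u \<and> u \<subseteq> v \<and> v \<subseteq> w"
    using w by (intro exI[of _ "{q}"]) auto
qed

text \<open>A node determines its last label \<open>K\<close> as the least number whose factorial clears its denominator.\<close>
lemma fact_mult_Ints_mono:
  fixes q :: real
  assumes "fact K * q \<in> \<int>" "K \<le> L"
  shows "fact L * q \<in> \<int>"
proof -
  obtain k where "(fact L :: nat) = fact K * k" using fact_dvd[OF assms(2)] by (elim dvdE)
  then have "(fact L :: real) = fact K * real k" by (metis of_nat_fact of_nat_mult)
  then have "fact L * q = real k * (fact K * q)" by (simp only: mult_ac)
  also have "\<dots> \<in> \<int>" by (intro Ints_mult assms(1)) simp
  finally show ?thesis .
qed

lemma fact_mult_node: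
  shows "fact (lab x n i) * node x n i \<in> \<int>" "fact (lab x n i - 1) * node x n i \<notin> \<int>"
proof -
  let ?s = "ssum (lab x n) (insert i (past (bits x n) i))"
  have *: "fact (lab x n i) * ?s \<in> \<int>" "fact (lab x n i - 1) * ?s \<notin> \<int>"
    by (intro fact_mult_ssum_top labelling_lab; simp add: past_def)+
  have fn: "(fact k :: real) * real n \<in> \<int>" for k
    by (metis Ints_of_nat of_nat_fact of_nat_mult)
  show "fact (lab x n i) * node x n i \<in> \<int>"
    using *(1) fn by (auto simp: node_def distrib_left intro: Ints_add)
  show "fact (lab x n i - 1) * node x n i \<notin> \<int>"
  proof
    assume "fact (lab x n i - 1) * node x n i \<in> \<int>"
    from Ints_diff[OF this fn[of "lab x n i - 1"]] *(2) show False
      by (simp add: node_def distrib_left)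
  qed
qed

lemma node_eq_imp_lab_le:
  assumes "node x n i = node y m j"
  shows "lab y m j \<le> lab x n i"
proof (rule ccontr)
  assume "\<not> ?thesis"
  then have "fact (lab y m j - 1) * node x n i \<in> \<int>"
    by (intro fact_mult_Ints_mono[OF fact_mult_node(1)]) auto
  then show False using fact_mult_node(2)[of y m j] assms by simp
qed

text \<open>At a common node the last labels agree, so \<open>x\<close> and \<open>y\<close>
  coincide before its time. That time cannot exceed a place \<open>u\<close> where they
  differ.\<close>

lemma finite_supp_Int:
  assumes "x \<noteq> y"
  shows "finite (supp (law x) \<inter> supp (law y))"
proof -
  obtain u where u: "x u \<noteq> y u" using assms by auto
  have "supp (law x) \<inter> supp (law y) \<subseteq> (\<lambda>t. case prod_decode t of (n, i) \<Rightarrow> node x n i) ` {..u}"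
  proof
    fix q assume "q \<in> supp (law x) \<inter> supp (law y)"
    then have "q \<in> (\<Union>n. nodes x n)" "q \<in> (\<Union>n. nodes y n)" using supp_law_subset by blast+
    then obtain n i m j where q: "q = node x n i" "q = node y m j"
      unfolding nodes_def by blast
    then have "lab x n i = lab y m j"
      using node_eq_imp_lab_le[of x n i y m j] node_eq_imp_lab_le[of y m j x n i] by simp
    then have "\<forall>s<prod_encode (n, i). x s = y s"
      unfolding lab_def by (blast dest: history_code_eqD)
    then have "prod_encode (n, i) \<le> u" using u by (meson not_le)
    then show "q \<in> (\<lambda>t. case prod_decode t of (n, i) \<Rightarrow> node x n i) ` {..u}"
      using q by (intro image_eqI[of _ _ "prod_encode (n, i)"]) auto
  qed
  then show ?thesis by (rule finite_subset) simp
qed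

subsection \<open>Avoiding \<open>\<sigma>\<close>-uniformly tight sets\<close>

lemma ex_recursive_seq:
  fixes G :: "(nat \<Rightarrow> 'a) \<Rightarrow> nat \<Rightarrow> 'a"
  assumes "\<And>x y t. (\<And>s. s < t \<Longrightarrow> x s = y s) \<Longrightarrow> G x t = G y t"
  shows "\<exists>x. \<forall>t. x t = G x t"
proof -
  \<comment> \<open>\<open>X t\<close> is final below \<open>t\<close>; the default elsewhere has no
    influence, as \<open>G\<close> depends only on earlier values.\<close>
  define X where "X = rec_nat (\<lambda>_. undefined) (\<lambda>t f. f(t := G f t))"
  have upd: "X (Suc t) = (X t)(t := G (X t) t)" for t by (simp add: X_def)
  define x where "x t = X (Suc t) t" for t
  have "X t s = x s" if "s < t" for s t
    using that
  proof (induction t)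
    case (Suc t)
    then show ?case by (cases "s = t") (auto simp: upd x_def less_Suc_eq)
  qed simp
  then have "x t = G x t" for t
    using assms[of t "X t" x] by (simp add: x_def upd)
  then show ?thesis by blast
qed

text \<open>All strategies can be imposed at once, since each bit is prescribed by a position that
  earlier bits determine.\<close>

lemma ex_follows:
  "\<exists>x. (\<forall>t<N. x t = x0 t) \<and> (\<forall>n\<ge>N. follows x n (D n))"
proof -
  define G where "G x t = (if t < N then x0 t else case prod_decode t of (n, j) \<Rightarrow> place x n j \<in> D n)" for x t
  have "\<exists>x. \<forall>t. x t = G x t"
  proof (rule ex_recursive_seq)
    fix x y :: "nat \<Rightarrow> bool" and t assume *: "\<And>s. s < t \<Longrightarrow> x s = y s"
    obtain n j where t: "t = prod_encode (n, j)" by (metis prod_decode_inverse surj_pair)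
    then have "place x n j = place y n j" using * by (intro place_cong) auto
    then show "G x t = G y t" by (simp add: G_def t)
  qed
  then obtain x where x: "\<And>t. x t = G x t" by blast
  have "follows x n (D n)" if "N \<le> n" for n
    unfolding follows_def
  proof
    fix j
    \<comment> \<open>Process \<open>n\<close> is read at times not below \<open>n\<close>, hence
      after the fixed prefix.\<close>
    have "N \<le> prod_encode (n, j)" using that le_prod_encode_1[of n j] by simp
    then show "x (prod_encode (n, j)) \<longleftrightarrow> place x n j \<in> D n"
      by (subst x) (simp add: G_def)
  qed
  moreover have "x t = x0 t" if "t < N" for t by (subst x) (simp add: G_def that)
  ultimately show ?thesis by blast
qed

lemma closed_follows: "closed {x. follows x n D}"
proof -
  have "closed {x. x (prod_encode (n, j)) \<longleftrightarrow> place x n j \<in> D}" for j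
  proof (rule closed_bool_seq)
    fix x y :: "nat \<Rightarrow> bool" assume *: "\<And>s. s < Suc (prod_encode (n, j)) \<Longrightarrow> x s = y s"
    then have "place x n j = place y n j" by (intro place_cong) auto
    then show "(x (prod_encode (n, j)) \<longleftrightarrow> place x n j \<in> D) =
        (y (prod_encode (n, j)) \<longleftrightarrow> place y n j \<in> D)"
      using *[of "prod_encode (n, j)"] by simp
  qed
  then show ?thesis unfolding follows_def by (rule closed_Collect_all)
qed

lemma closed_prefix: "closed {x :: nat \<Rightarrow> bool. \<forall>t<N. x t = x0 t}"
  by (rule closed_bool_seq[of N]) auto

lemma uniformly_tightD:
  assumes "uniformly_tight A" "0 < e"
  obtains C where "C \<subseteq> \<rat>" "compact C" "\<And>\<mu>. \<mu> \<in> A \<Longrightarrow> measure \<mu> (\<rat> - C) < e"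
  using assms by (auto simp: uniformly_tight_def)

text \<open>Tightness with bound \<open>mass n\<close> would give a compact set from which process
  \<open>n\<close> cannot escape.\<close>

lemma not_uniformly_tight_follows:
  assumes "\<And>D. compact D \<Longrightarrow> D \<subseteq> \<rat> \<Longrightarrow> \<exists>x\<in>Y. follows x n D"
  shows "\<not> uniformly_tight (law ` Y)"
proof
  assume "uniformly_tight (law ` Y)"
  then obtain D where D: "D \<subseteq> \<rat>" "compact D" "\<And>x. x \<in> Y \<Longrightarrow> measure (law x) (\<rat> - D) < mass n"
    using uniformly_tightD[OF _ mass_pos[of n]] by (metis imageI)
  then obtain x where "x \<in> Y" "follows x n D" using assms by blast
  then show False using follows_imp_mass[of x n D] D by force
qed

text \<open>Process \<open>Suc N + k\<close> escapes from a compact set carrying the measures of the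
  \<open>k\<close>-th piece up to less than \<open>mass (Suc N + k)\<close>. Process
  \<open>N\<close> stays free and destroys tightness.\<close>

lemma avoid_sigma_uniformly_tight:
  assumes "sigma_uniformly_tight A"
  shows "\<exists>C. C \<subseteq> law ` {x. \<forall>t<N. x t = x0 t} - A \<and> compactin weak_topology C \<and> \<not> uniformly_tight C"
proof -
  obtain \<F> where F: "countable \<F>" "\<And>B. B \<in> \<F> \<Longrightarrow> uniformly_tight B" "A \<subseteq> \<Union>\<F>"
    using assms by (auto simp: sigma_uniformly_tight_def)
  \<comment> \<open>The empty set is added so that an empty family can be enumerated too.\<close>
  define B where "B = from_nat_into (insert {} \<F>)"
  have rB: "range B = insert {} \<F>"
    unfolding B_def using F(1) by (intro range_from_nat_into) auto
  have "uniformly_tight {}" by (auto simp: uniformly_tight_def)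
  then have "uniformly_tight (B k)" for k using F(2) rB by (metis insert_iff rangeI)
  then have "\<exists>D. D \<subseteq> \<rat> \<and> compact D \<and> (\<forall>\<mu>\<in>B k. measure \<mu> (\<rat> - D) < mass (Suc N + k))" for k
    using uniformly_tightD[OF _ mass_pos[of "Suc N + k"]] by metis
  then obtain D where D: "\<And>k. D k \<subseteq> \<rat>" "\<And>k. compact (D k)"
      "\<And>k \<mu>. \<mu> \<in> B k \<Longrightarrow> measure \<mu> (\<rat> - D k) < mass (Suc N + k)"
    by metis
  define Y where "Y = {x. \<forall>t<N. x t = x0 t} \<inter> (\<Inter>k. {x. follows x (Suc N + k) (D k)})"
  have "closed Y"
    unfolding Y_def by (intro closed_Int closed_prefix closed_INT ballI closed_follows)
  then have "compact Y" using compact_bool_seq compact_Int_closed[of UNIV Y] by simp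
  have "law x \<notin> A" if "x \<in> Y" for x
  proof
    assume "law x \<in> A"
    then obtain k where k: "law x \<in> B k" using F(3) rB by (metis UnionE insertI2 rangeE subsetD)
    have "follows x (Suc N + k) (D k)" using that by (auto simp: Y_def)
    from follows_imp_mass[OF this D(2,1)] D(3)[OF k] show False by simp
  qed
  moreover have "\<not> uniformly_tight (law ` Y)"
  proof (rule not_uniformly_tight_follows[of _ N])
    fix E :: "real set"
    obtain x where x: "\<And>t. t < N \<Longrightarrow> x t = x0 t"
        "\<And>n. N \<le> n \<Longrightarrow> follows x n (if n = N then E else D (n - Suc N))"
      using ex_follows[of N x0 "\<lambda>n. if n = N then E else D (n - Suc N)"] by blast
    have "follows x N E" using x(2)[of N] by simp
    moreover have "follows x (Suc N + k) (D k)" for k using x(2)[of "Suc N + k"] by simp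
    ultimately show "\<exists>x\<in>Y. follows x N E" using x(1) by (auto simp: Y_def)
  qed
  ultimately show ?thesis
    using compactin_law_image[OF \<open>compact Y\<close>]
    by (intro exI[of _ "law ` Y"]) (auto simp: Y_def)
qed

theorem theorem1p3:
  shows "\<exists>K. compactin weak_topology K \<and> K \<noteq> {} \<and>
    (\<forall>\<mu>\<in>K. locally compact (supp \<mu>)) \<and>
    (\<forall>\<mu>\<in>K. \<forall>\<nu>\<in>K. \<mu> \<noteq> \<nu> \<longrightarrow> finite (supp \<mu> \<inter> supp \<nu>)) \<and>
    (\<forall>V. openin (subtopology weak_topology K) V \<and> V \<noteq> {} \<longrightarrow>
      (\<exists>L. L \<subseteq> V \<and> compactin weak_topology L \<and>
        (\<forall>A. A \<subseteq> K \<and> sigma_uniformly_tight A \<longrightarrow>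
          (\<exists>C. C \<subseteq> L - A \<and> compactin weak_topology C \<and> \<not> uniformly_tight C))))"
proof (rule exI[of _ "range law"], intro conjI allI impI)
  show "compactin weak_topology (range law)"
    by (rule compactin_law_image[OF compact_bool_seq])
  show "\<forall>\<mu>\<in>range law. locally compact (supp \<mu>)"
    using locally_compact_supp_law by blast
  show "\<forall>\<mu>\<in>range law. \<forall>\<nu>\<in>range law. \<mu> \<noteq> \<nu> \<longrightarrow> finite (supp \<mu> \<inter> supp \<nu>)"
    by (auto intro!: finite_supp_Int)
  fix V assume V: "openin (subtopology weak_topology (range law)) V \<and> V \<noteq> {}"
  then obtain T where T: "openin weak_topology T" "V = T \<inter> range law"
    by (auto simp: openin_subtopology)
  then obtain x where x: "law x \<in> T" using V by auto
  have op: "open (law -` T)"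
    using openin_continuous_map_preimage[OF continuous_map_law T(1)] by (simp add: vimage_def)
  have "\<exists>N. \<forall>y. (\<forall>s<N. y s = x s) \<longrightarrow> y \<in> law -` T"
    by (rule bspec[OF iffD1[OF open_bool_seq_iff op]]) (simp add: x)
  then obtain N where N: "\<And>y. (\<forall>s<N. y s = x s) \<Longrightarrow> law y \<in> T" by auto
  \<comment> \<open>A cylinder whose laws all lie in \<open>V\<close>, fixed before \<open>A\<close>
    is given.\<close>
  let ?P = "{y. \<forall>t<N. y t = x t}"
  have "compact ?P" using compact_Int_closed[OF compact_bool_seq closed_prefix] by simp
  then have "compactin weak_topology (law ` ?P)" by (rule compactin_law_image)
  moreover have "law ` ?P \<subseteq> V" using N T(2) by auto
  moreover have "\<exists>C. C \<subseteq> law ` ?P - A \<and> compactin weak_topology C \<and> \<not> uniformly_tight C"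
    if "sigma_uniformly_tight A" for A
    using avoid_sigma_uniformly_tight[OF that, of N x] .
  ultimately show "\<exists>L. L \<subseteq> V \<and> compactin weak_topology L \<and>
        (\<forall>A. A \<subseteq> range law \<and> sigma_uniformly_tight A \<longrightarrow>
          (\<exists>C. C \<subseteq> L - A \<and> compactin weak_topology C \<and> \<not> uniformly_tight C))"
    by (intro exI[of _ "law ` ?P"]) simp
qed simp

end
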